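(* Let $\{f_k\}_{k=0}^\infty$ and $\{g_k\}_{k=0}^\infty$ be sequences in $\mathcal{H}$ such that $\{(f_k,g_k)\}_{k=0}^\infty$ is a biorthogonal system and $\{f_k\}_{k=0}^\infty$ is spanning, that is, $\bigvee_{k\ge 0}\{f_k\}=\mathcal{H}$. Suppose moreover that $T\in\mathcal{L}(\mathcal{H})$ is a backward shift on $\{f_k\}_{k=0}^\infty$, i.e. $Tf_0=0$ and $Tf_k=f_{k-1}$ for $k\ge 1$. Then: (1) the sequence $\{g_k\}_{k=0}^\infty$ is a generalized basis of $\mathcal{H}$; (2) the adjoint operator $T^*$ is a forward shift on the generalized basis $\{g_k\}_{k=0}^\infty$, that is, $T^*g_k=g_{k+1}$ for $k=0,1,\ldots$.
   Context: $\mathcal{H}$ is a separable, infinite dimensional complex Hilbert space with inner product $(\cdot,\cdot)$, $\mathcal{L}(\mathcal{H})$ is the algebra of bounded linear operators on $\mathcal{H}$, and $\bigvee$ denotes closed linear span. $\{(f_k,g_k)\}_{k=0}^\infty$ is a biorthogonal system if $(f_i,g_j)=\delta_{ij}$ for all $i,j\ge 0$. A sequence $\{g_k\}_{k=0}^\infty$ in $\mathcal{H}$ is a generalized basis of $\mathcal{H}$ if there is a sequence $\{h_k\}_{k=0}^\infty$ in $\mathcal{H}$ with $(g_i,h_j)=\delta_{ij}$ for all $i,j\ge 0$ which is total, i.e. $\{x\in\mathcal{H}:(x,h_k)=0\ \forall k\ge 0\}=\{0\}$. *)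

theory Defs
  imports "HOL-Analysis.Analysis"
begin

text \<open>
  Complex inner product spaces. The class sits on top of \<open>real_inner\<close>: the underlying
  real inner product is the real part of \<open>cinner\<close>. So the norm is \<open>sqrt (cinner x x)\<close>, and the
  norm, the topology and positive definiteness are those of \<open>real_inner\<close>; the two lemmas
  \<open>cinner_self\<close> and \<open>norm_eq_sqrt_cinner\<close> make this explicit.
  The inner product is linear in its first argument.
\<close>

class complex_inner = real_inner +
  fixes scaleC :: "complex \<Rightarrow> 'a \<Rightarrow> 'a" (infixr \<open>*\<^sub>C\<close> 75)
    and cinner :: "'a \<Rightarrow> 'a \<Rightarrow> complex"
  assumes scaleC_add_right: "a *\<^sub>C (x + y) = a *\<^sub>C x + a *\<^sub>C y"
    and scaleC_add_left: "(a + b) *\<^sub>C x = a *\<^sub>C x + b *\<^sub>C x"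
    and scaleC_scaleC: "a *\<^sub>C b *\<^sub>C x = (a * b) *\<^sub>C x"
    and scaleC_one: "1 *\<^sub>C x = x"
    and scaleR_scaleC: "r *\<^sub>R x = complex_of_real r *\<^sub>C x"
    and cinner_commute: "cinner x y = cnj (cinner y x)"
    and cinner_add_left: "cinner (x + y) z = cinner x z + cinner y z"
    and cinner_scaleC_left: "cinner (a *\<^sub>C x) y = a * cinner x y"
    and inner_eq_Re_cinner: "inner x y = Re (cinner x y)"

class chilbert_space = complex_inner + complete_space

lemma vector_space_scaleC: "vector_space (scaleC :: complex \<Rightarrow> 'a \<Rightarrow> 'a::complex_inner)"
  by unfold_locales (simp_all add: scaleC_add_right scaleC_add_left scaleC_scaleC scaleC_one)

lemma cinner_self: "cinner x x = complex_of_real (inner x x)"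
proof -
  have "Im (cinner x x) = 0"
    using arg_cong[OF cinner_commute[of x x], of Im] by simp
  then show ?thesis
    by (simp add: complex_eq_iff inner_eq_Re_cinner)
qed

lemma norm_eq_sqrt_cinner: "norm x = sqrt (cmod (cinner x x))"
  unfolding cinner_self norm_of_real by (simp add: norm_eq_sqrt_inner[of x])

definition cspan :: "'a::complex_inner set \<Rightarrow> 'a set"
  where "cspan = module.span scaleC"

definition closed_cspan :: "'a::complex_inner set \<Rightarrow> 'a set"
  where "closed_cspan S = closure (cspan S)"

definition infinite_cdim :: "'a::complex_inner itself \<Rightarrow> bool"
  where "infinite_cdim _ \<longleftrightarrow> \<not> (\<exists>B :: 'a set. finite B \<and> cspan B = UNIV)"

definition bounded_clinear :: "('a::complex_inner \<Rightarrow> 'b::complex_inner) \<Rightarrow> bool"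
  where "bounded_clinear T \<longleftrightarrow> bounded_linear T \<and> (\<forall>a x. T (a *\<^sub>C x) = a *\<^sub>C T x)"

text \<open>
  The library constant \<open>adjoint\<close> is taken with respect to \<open>inner\<close>; this is the adjoint with
  respect to \<open>cinner\<close>.
\<close>

definition cadjoint :: "('a::complex_inner \<Rightarrow> 'b::complex_inner) \<Rightarrow> 'b \<Rightarrow> 'a"
  where "cadjoint T = (THE S. bounded_clinear S \<and> (\<forall>x y. cinner (T x) y = cinner x (S y)))"

definition biorthogonal :: "(nat \<Rightarrow> 'a::complex_inner) \<Rightarrow> (nat \<Rightarrow> 'a) \<Rightarrow> bool"
  where "biorthogonal f g \<longleftrightarrow> (\<forall>i j. cinner (f i) (g j) = (if i = j then 1 else 0))"

definition total_seq :: "(nat \<Rightarrow> 'a::complex_inner) \<Rightarrow> bool"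
  where "total_seq h \<longleftrightarrow> {x. \<forall>k. cinner x (h k) = 0} = {0}"

definition generalized_basis :: "(nat \<Rightarrow> 'a::complex_inner) \<Rightarrow> bool"
  where "generalized_basis g \<longleftrightarrow> (\<exists>h. biorthogonal g h \<and> total_seq h)"

definition backward_shift_on :: "('a::complex_inner \<Rightarrow> 'a) \<Rightarrow> (nat \<Rightarrow> 'a) \<Rightarrow> bool"
  where "backward_shift_on T f \<longleftrightarrow> T (f 0) = 0 \<and> (\<forall>k\<ge>1. T (f k) = f (k - 1))"

definition forward_shift_on :: "('a::complex_inner \<Rightarrow> 'a) \<Rightarrow> (nat \<Rightarrow> 'a) \<Rightarrow> bool"
  where "forward_shift_on S g \<longleftrightarrow> (\<forall>k. S (g k) = g (k + 1))"

end

theory Submission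
  imports Defs
begin

text \<open>
  Conjugating the biorthogonality relations shows that \<open>f\<close> is dual to \<open>g\<close>, and it is total
  because a vector orthogonal to a spanning sequence vanishes. By the same totality, \<open>T\<^sup>* g\<^sub>k\<close> is
  determined by its inner products with the \<open>f\<^sub>j\<close>, and \<open>(f\<^sub>j, T\<^sup>* g\<^sub>k) = (T f\<^sub>j, g\<^sub>k)\<close> agrees
  with \<open>(f\<^sub>j, g\<^sub>k\<^sub>+\<^sub>1)\<close>. The adjoint exists by the Riesz representation theorem, whose representing
  vector is found by minimising \<open>\<parallel>x\<parallel>\<^sup>2 - 2 \<phi> x\<close>.
\<close>

text \<open>Boundedness of \<open>\<phi>\<close> keeps the functional bounded below. The
  parallelogram law makes a minimising sequence Cauchy, and by continuity its limit attains the
  infimum.\<close>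

lemma ex_minimum_quadratic:
  fixes \<phi> :: "'a::{real_inner, complete_space} \<Rightarrow> real"
  assumes "bounded_linear \<phi>"
  shows "\<exists>u. \<forall>x. inner u u - 2 * \<phi> u \<le> inner x x - 2 * \<phi> x"
proof -
  interpret bounded_linear \<phi> by fact
  define J where "J x = inner x x - 2 * \<phi> x" for x
  obtain K where K: "\<And>x. norm (\<phi> x) \<le> norm x * K"
    using bounded by blast
  have lower: "- K\<^sup>2 \<le> J x" for x
  proof -
    \<comment> \<open>Completing the square: \<open>J x\<close> is at least
      \<open>(norm x - K)\<^sup>2 - K\<^sup>2\<close>.\<close>
    have "0 \<le> (norm x - K)\<^sup>2" by simp
    moreover have "\<phi> x \<le> norm x * K" using K[of x] by simp
    ultimately show ?thesis
      by (simp add: J_def power2_diff dot_square_norm)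
  qed
  define m where "m = Inf (range J)"
  have bdd: "bdd_below (range J)"
    using lower by (auto intro!: bdd_belowI)
  have m_le: "m \<le> J x" for x
    unfolding m_def using bdd by (simp add: cINF_lower)
  have "\<exists>x. J x < m + inverse (Suc n)" for n
  proof -
    have "Inf (range J) < m + inverse (Suc n)" by (simp add: m_def)
    then show ?thesis using cInf_lessD[of "range J"] by blast
  qed
  then obtain X where X: "\<And>n. J (X n) < m + inverse (real (Suc n))" by metis
  \<comment> \<open>The linear terms cancel at the midpoint. As \<open>J\<close> is at least
    \<open>m\<close> there, two near-minimisers must be close to each other.\<close>
  have parallelogram: "J x + J y - 2 * J ((1/2) *\<^sub>R (x + y)) = (norm (x - y))\<^sup>2 / 2" for x y
    by (simp add: J_def add scale power2_norm_eq_inner inner_simps inner_commute algebra_simps)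
  have dist_le: "(norm (x - y))\<^sup>2 \<le> 2 * (J x - m) + 2 * (J y - m)" for x y
    using parallelogram[of x y] m_le[of "(1/2) *\<^sub>R (x + y)"] by simp
  have "Cauchy X"
  proof (rule metric_CauchyI)
    fix e :: real assume "0 < e"
    \<comment> \<open>\<open>dist_le\<close> doubles each of the two excesses over \<open>m\<close>,
      so a quarter of \<open>e\<^sup>2\<close> is allotted to each.\<close>
    then obtain N where N: "inverse (real (Suc N)) < e\<^sup>2 / 4"
      using reals_Archimedean[of "e\<^sup>2 / 4"] by auto
    have close: "J (X n) - m < e\<^sup>2 / 4" if "n \<ge> N" for n
    proof -
      have "inverse (real (Suc n)) \<le> inverse (real (Suc N))"
        using that by (simp add: field_simps)
      with X[of n] N show ?thesis by linarith
    qed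
    have "dist (X i) (X j) < e" if "i \<ge> N" "j \<ge> N" for i j
    proof -
      note dist_le[of "X i" "X j"]
      also have "2 * (J (X i) - m) + 2 * (J (X j) - m) < 2 * (e\<^sup>2 / 4) + 2 * (e\<^sup>2 / 4)"
        using close[OF that(1)] close[OF that(2)] by (intro add_strict_mono mult_strict_left_mono) simp_all
      also have "\<dots> = e\<^sup>2" by simp
      finally have "(norm (X i - X j))\<^sup>2 < e\<^sup>2" .
      then show ?thesis
        using \<open>0 < e\<close> by (simp add: dist_norm power_less_imp_less_base)
    qed
    then show "\<exists>M. \<forall>i\<ge>M. \<forall>j\<ge>M. dist (X i) (X j) < e" by blast
  qed
  then obtain u where u: "X \<longlonglongrightarrow> u"
    using Cauchy_convergent convergent_def by blast
  have "(\<lambda>n. J (X n)) \<longlonglongrightarrow> J u"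
    unfolding J_def by (intro tendsto_intros tendsto u)
  moreover have "(\<lambda>n. m + inverse (real (Suc n))) \<longlonglongrightarrow> m + 0"
    by (intro tendsto_intros LIMSEQ_inverse_real_of_nat)
  ultimately have "J u \<le> m + 0"
    using X by (intro LIMSEQ_le) (auto intro: less_imp_le)
  then have "J u \<le> J x" for x
    using m_le[of x] by simp
  then show ?thesis unfolding J_def by blast
qed

text \<open>First variation: at the minimiser \<open>u\<close> no direction \<open>x\<close> can
  decrease the quadratic functional.\<close>

lemma riesz_representation:
  fixes \<phi> :: "'a::{real_inner, complete_space} \<Rightarrow> real"
  assumes "bounded_linear \<phi>"
  shows "\<exists>u. \<forall>x. \<phi> x = inner x u"
proof -
  interpret bounded_linear \<phi> by fact
  obtain u where u: "\<And>x. inner u u - 2 * \<phi> u \<le> inner x x - 2 * \<phi> x"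
    using ex_minimum_quadratic[OF assms] by blast
  have "\<phi> x = inner x u" for x
  proof (rule ccontr)
    assume neq: "\<phi> x \<noteq> inner x u"
    define d where "d = \<phi> x - inner x u"
    \<comment> \<open>Moving from \<open>u\<close> to \<open>u + t *\<^sub>R x\<close> changes the
      functional by \<open>t * t * inner x x - 2 * (t * d)\<close>. This \<open>t\<close> minimises
      the change, with value \<open>- (d * d / inner x x)\<close>.\<close>
    define t where "t = d / inner x x"
    have "x \<noteq> 0" using neq by (auto simp: zero)
    then have pos: "0 < inner x x" by simp
    have "0 \<le> t * t * inner x x - 2 * (t * d)"
      using u[of "u + t *\<^sub>R x"]
      by (simp add: add scale inner_simps inner_commute d_def algebra_simps)
    moreover have "t * t * inner x x = t * d"
      using pos by (simp add: t_def)
    ultimately have "d * d / inner x x \<le> 0" by (simp add: t_def)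
    then have "d * d \<le> 0" using pos by (simp add: divide_le_0_iff)
    then have "d = 0" by (auto simp: mult_le_0_iff)
    then show False using neq by (simp add: d_def)
  qed
  then show ?thesis by blast
qed

lemma cinner_add_right: "cinner x (y + z) = cinner x y + cinner x z"
  by (metis cinner_add_left cinner_commute complex_cnj_add)

lemma cinner_scaleC_right: "cinner x (a *\<^sub>C y) = cnj a * cinner x y"
  by (metis cinner_commute cinner_scaleC_left complex_cnj_mult)

lemma cinner_zero_left [simp]: "cinner 0 x = 0"
  using cinner_add_left[of 0 0 x] by simp

lemma cinner_diff_right: "cinner x (y - z) = cinner x y - cinner x z"
  using cinner_add_right[of x "y - z" z] by simp

lemma Im_cinner: "Im (cinner x y) = inner ((- \<i>) *\<^sub>C x) y"
  by (simp add: inner_eq_Re_cinner cinner_scaleC_left)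

text \<open>Reduces identities for \<open>cinner\<close> to identities for \<open>inner\<close>, so
  that the real Riesz theorem suffices for the complex adjoint.\<close>

lemma cinner_eq_inner: "cinner x y = Complex (inner x y) (inner ((- \<i>) *\<^sub>C x) y)"
  by (simp add: complex_eq_iff Im_cinner inner_eq_Re_cinner)

lemma cinner_left_cancel:
  assumes "\<And>x. cinner x y = cinner x z"
  shows "y = z"
proof -
  have "cinner (y - z) (y - z) = 0" using assms by (simp add: cinner_diff_right)
  then show ?thesis by (simp add: cinner_self)
qed

lemma ex_cadjoint:
  fixes T :: "'a::chilbert_space \<Rightarrow> 'b::complex_inner"
  assumes "bounded_clinear T"
  shows "\<exists>S. bounded_clinear S \<and> (\<forall>x y. cinner (T x) y = cinner x (S y))"
proof -
  have bl: "bounded_linear T" and Tc: "\<And>a x. T (a *\<^sub>C x) = a *\<^sub>C T x"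
    using assms by (auto simp: bounded_clinear_def)
  have "\<exists>u. \<forall>x. inner (T x) y = inner x u" for y
    using riesz_representation[OF bounded_linear_compose[OF bounded_linear_inner_left bl]]
    by simp
  then obtain S where S: "\<And>x y. inner (T x) y = inner x (S y)" by metis
  \<comment> \<open>Since \<open>T\<close> commutes with multiplication by \<open>- \<i>\<close>,
    the real adjoint identity at \<open>(- \<i>) *\<^sub>C x\<close> yields the imaginary
    part.\<close>
  have Sc: "cinner (T x) y = cinner x (S y)" for x y
    by (simp add: cinner_eq_inner Tc[symmetric] S)
  have add: "S (x + y) = S x + S y" for x y
    by (rule cinner_left_cancel) (simp add: Sc[symmetric] cinner_add_right)
  have scale: "S (a *\<^sub>C x) = a *\<^sub>C S x" for a x
    by (rule cinner_left_cancel) (simp add: Sc[symmetric] cinner_scaleC_right)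
  obtain K where "0 \<le> K" and K: "\<And>x. norm (T x) \<le> norm x * K"
    using bounded_linear.nonneg_bounded[OF bl] by blast
  have "norm (S y) \<le> norm y * K" for y
  proof (cases "S y = 0")
    case True
    then show ?thesis using \<open>0 \<le> K\<close> by simp
  next
    case False
    \<comment> \<open>Test the adjoint identity at \<open>x = S y\<close>; a factor
      \<open>norm (S y)\<close> is cancelled at the end.\<close>
    have "norm (S y) * norm (S y) = inner (T (S y)) y"
      by (simp add: S flip: power2_eq_square power2_norm_eq_inner)
    also have "\<dots> \<le> norm (T (S y)) * norm y" by (rule norm_cauchy_schwarz)
    also have "\<dots> \<le> norm (S y) * K * norm y" by (intro mult_right_mono K) simp
    finally show ?thesis using False by (simp add: mult.assoc mult.commute)
  qed
  then have "bounded_linear S"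
    by (intro bounded_linear_intro) (auto simp: add scale scaleR_scaleC)
  then show ?thesis
    using Sc scale unfolding bounded_clinear_def by blast
qed

lemma cinner_cadjoint:
  fixes T :: "'a::chilbert_space \<Rightarrow> 'b::complex_inner"
  assumes "bounded_clinear T"
  shows "cinner (T x) y = cinner x (cadjoint T y)"
proof -
  let ?P = "\<lambda>S. bounded_clinear S \<and> (\<forall>x y. cinner (T x) y = cinner x (S y))"
  have "\<exists>!S. ?P S"
  proof (rule ex_ex1I)
    show "\<exists>S. ?P S" using assms by (rule ex_cadjoint)
    show "S = S'" if "?P S" "?P S'" for S S'
      using that by (intro ext cinner_left_cancel) metis
  qed
  from theI'[OF this] show ?thesis unfolding cadjoint_def by blast
qed

text \<open>The vectors orthogonal to \<open>x\<close> form a closed complex subspace, which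
  contains the closed span as soon as it contains \<open>S\<close>.\<close>

lemma cinner_eq_zero_closed_cspan:
  assumes "\<And>s. s \<in> S \<Longrightarrow> cinner s x = 0" and "z \<in> closed_cspan S"
  shows "cinner z x = 0"
proof -
  interpret vector_space "scaleC :: complex \<Rightarrow> 'a \<Rightarrow> 'a" by (rule vector_space_scaleC)
  define V where "V = {z. cinner z x = 0}"
  \<comment> \<open>The two real conditions say that the real and the imaginary part of
    \<open>cinner z x\<close> vanish.\<close>
  have "closed ({z. inner z x = 0} \<inter> {z. inner z (\<i> *\<^sub>C x) = 0})"
    by (intro closed_Int closed_Collect_eq continuous_intros)
  also have "{z. inner z x = 0} \<inter> {z. inner z (\<i> *\<^sub>C x) = 0} = V"
    by (auto simp: V_def inner_eq_Re_cinner cinner_scaleC_right complex_eq_iff)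
  finally have "closed V" .
  moreover have "subspace V"
    by (auto simp: subspace_def V_def cinner_add_left cinner_scaleC_left)
  moreover have "S \<subseteq> V" using assms(1) by (auto simp: V_def)
  ultimately have "closed_cspan S \<subseteq> V"
    unfolding closed_cspan_def cspan_def by (intro closure_minimal span_minimal)
  then show ?thesis using assms(2) by (auto simp: V_def)
qed

lemma eq_zero_if_orthogonal_spanning:
  assumes "closed_cspan S = UNIV" and "\<And>s. s \<in> S \<Longrightarrow> cinner s x = 0"
  shows "x = 0"
  using cinner_eq_zero_closed_cspan[OF assms(2), where z = x] assms(1) by (simp add: cinner_self)

lemma biorthogonal_sym: "biorthogonal f g \<Longrightarrow> biorthogonal g f"
  unfolding biorthogonal_def by (metis cinner_commute complex_cnj_one complex_cnj_zero)

lemma spanning_imp_total_seq: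
  assumes "closed_cspan (range f) = UNIV"
  shows "total_seq f"
proof -
  have "x = 0" if "\<And>k. cinner x (f k) = 0" for x
    using that eq_zero_if_orthogonal_spanning[OF assms, of x]
    by (metis cinner_commute complex_cnj_zero rangeE)
  then show ?thesis unfolding total_seq_def by auto
qed

theorem lemma3p10:
  fixes f g :: "nat \<Rightarrow> 'a::chilbert_space"
    and T :: "'a \<Rightarrow> 'a"
  assumes separable: "separable_space (euclidean :: 'a topology)"
    and infinite_dim: "infinite_cdim TYPE('a)"
    and biorthogonal: "biorthogonal f g"
    and spanning: "closed_cspan (range f) = UNIV"
    and bounded: "bounded_clinear T"
    and shift: "backward_shift_on T f"
  shows "generalized_basis g \<and> forward_shift_on (cadjoint T) g"
proof
  show "generalized_basis g"
    unfolding generalized_basis_def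
    using biorthogonal_sym[OF biorthogonal] spanning_imp_total_seq[OF spanning] by blast
  \<comment> \<open>For \<open>j = 0\<close> both terms vanish, as \<open>T (f 0) = 0\<close> and
    \<open>k + 1\<close> is never \<open>0\<close>. For \<open>j = Suc i\<close> both are 1 if
    \<open>i = k\<close> and 0 otherwise.\<close>
  have "cinner (f j) (cadjoint T (g k) - g (k + 1)) = 0" for j k
    using biorthogonal shift
    by (cases j) (simp_all add: cinner_diff_right cinner_cadjoint[OF bounded, symmetric]
        biorthogonal_def backward_shift_on_def)
  then have "cadjoint T (g k) - g (k + 1) = 0" for k
    by (intro eq_zero_if_orthogonal_spanning[OF spanning]) auto
  then show "forward_shift_on (cadjoint T) g"
    by (simp add: forward_shift_on_def)
qed

end
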